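(* Let $N\ge2$ and $1\le m\le M$, and let $\{\mathcal{W}_i\}_{i=1}^N$ be a fusion frame for $\mathbb{R}^M$ of $m$-dimensional subspaces with equal pairwise chordal distances $d_c$. Then the fusion frame is tight if and only if $d_c$ equals the simplex bound, i.e. if and only if $$d_c^2=\frac{m(M-m)}{M}\,\frac{N}{N-1}.$$
   Context: A fusion frame for $\mathbb{R}^M$ is a finite collection of subspaces $\{\mathcal{W}_i\}_{i=1}^N$ of $\mathbb{R}^M$ whose orthogonal projections $\mathbf{P}_i$ satisfy $A\,\mathbf{I}\le\sum_{i=1}^N\mathbf{P}_i\le B\,\mathbf{I}$ for some constants $0<A\le B<\infty$. It is tight if $A$ and $B$ can be chosen equal, i.e. $\sum_{i=1}^N\mathbf{P}_i=A\,\mathbf{I}$ for some $A>0$. The chordal distance between two $m$-dimensional subspaces $\mathcal{W}_i,\mathcal{W}_j$ is $d_c(i,j)=\frac{1}{\sqrt2}\|\mathbf{P}_i-\mathbf{P}_j\|$, with the Frobenius (Euclidean) norm of matrices; equivalently $d_c^2(i,j)=\sum_{\ell=1}^m\sin^2\theta_\ell(i,j)=m-\mathrm{tr}[\mathbf{P}_i\mathbf{P}_j]$, where $\theta_1(i,j),\dots,\theta_m(i,j)$ are the principal angles between $\mathcal{W}_i$ and $\mathcal{W}_j$. Equal pairwise chordal distances $d_c$ means $d_c(i,j)=d_c$ for all $i\neq j$. *)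

theory Defs
  imports "HOL-Analysis.Analysis"
begin

definition is_orth_proj :: "(real^'n) set \<Rightarrow> real^'n^'n \<Rightarrow> bool" where
  "is_orth_proj W P \<longleftrightarrow> (\<forall>x. P *v x \<in> W \<and> (\<forall>w\<in>W. orthogonal (x - P *v x) w))"

definition orth_proj :: "(real^'n) set \<Rightarrow> real^'n^'n" where
  "orth_proj W = (THE P. is_orth_proj W P)"

text \<open>The description is proper for every subspace.\<close>

lemma is_orth_proj_ex1:
  fixes W :: "(real^'n) set"
  assumes W: "subspace W"
  shows "\<exists>!P. is_orth_proj W P"
proof -
  have uniq: "y = z"
    if "y \<in> W" "z \<in> W" "\<forall>w\<in>W. orthogonal (x - y) w" "\<forall>w\<in>W. orthogonal (x - z) w"
    for x y z :: "real^'n"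
  proof -
    have d: "y - z \<in> W" using that W by (simp add: subspace_diff)
    have "(x - y) \<bullet> (y - z) = 0" "(x - z) \<bullet> (y - z) = 0"
      using that(3,4) d by (auto simp: orthogonal_def)
    then have "(y - z) \<bullet> (y - z) = 0" by (simp add: inner_diff_left)
    then show ?thesis by simp
  qed
  have "\<forall>x. \<exists>y. y \<in> W \<and> (\<forall>w\<in>W. orthogonal (x - y) w)"
  proof
    fix x :: "real^'n"
    obtain y z where "y \<in> span W" "\<And>w. w \<in> span W \<Longrightarrow> orthogonal z w" "x = y + z"
      using orthogonal_subspace_decomp_exists[of W x] by blast
    moreover have "span W = W" using W by simp
    ultimately show "\<exists>y. y \<in> W \<and> (\<forall>w\<in>W. orthogonal (x - y) w)" by auto
  qed
  then obtain f where f: "\<And>x. f x \<in> W" "\<And>x w. w \<in> W \<Longrightarrow> orthogonal (x - f x) w"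
    by metis
  have "linear f"
  proof (rule linearI)
    fix x y :: "real^'n" and c :: real
    have "f (x + y) \<in> W" "f x + f y \<in> W"
      using f(1) W by (simp_all add: subspace_add)
    moreover have "orthogonal (x + y - (f x + f y)) w" if "w \<in> W" for w
    proof -
      have "orthogonal ((x - f x) + (y - f y)) w"
        using f(2)[OF that, of x] f(2)[OF that, of y]
        unfolding orthogonal_def by (simp only: inner_add_left add_0)
      then show ?thesis by (simp add: add_diff_add)
    qed
    ultimately show "f (x + y) = f x + f y"
      using uniq f(2) by blast
    have "f (c *\<^sub>R x) \<in> W" "c *\<^sub>R f x \<in> W"
      using f(1) W by (simp_all add: subspace_scale)
    moreover have "orthogonal (c *\<^sub>R x - c *\<^sub>R f x) w" if "w \<in> W" for w
    proof -
      have "orthogonal (c *\<^sub>R (x - f x)) w"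
        using f(2)[OF that] by (simp add: orthogonal_def)
      then show ?thesis by (simp add: scaleR_diff_right)
    qed
    ultimately show "f (c *\<^sub>R x) = c *\<^sub>R f x"
      using uniq f(2) by blast
  qed
  then have "is_orth_proj W (matrix f)"
    using f by (auto simp: is_orth_proj_def matrix_works)
  moreover have "P = Q" if "is_orth_proj W P" "is_orth_proj W Q" for P Q
  proof -
    have "P *v x = Q *v x" for x
      using that uniq[of "P *v x" "Q *v x" x] by (auto simp: is_orth_proj_def)
    then show ?thesis by (simp add: matrix_eq)
  qed
  ultimately show ?thesis by blast
qed

lemma is_orth_proj_orth_proj: "subspace W \<Longrightarrow> is_orth_proj W (orth_proj W)"
  unfolding orth_proj_def by (rule theI') (rule is_orth_proj_ex1)

text \<open>The Loewner order; intended for symmetric matrices, such as sums of orthogonal projections.\<close>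

definition loewner_le :: "real^'n^'n \<Rightarrow> real^'n^'n \<Rightarrow> bool" where
  "loewner_le S T \<longleftrightarrow> (\<forall>x. x \<bullet> (S *v x) \<le> x \<bullet> (T *v x))"

definition fusion_frame :: "'i set \<Rightarrow> ('i \<Rightarrow> (real^'n) set) \<Rightarrow> bool" where
  "fusion_frame I W \<longleftrightarrow> finite I \<and> (\<forall>i\<in>I. subspace (W i)) \<and>
     (\<exists>A B. 0 < A \<and> A \<le> B \<and>
        loewner_le (A *\<^sub>R mat 1) (\<Sum>i\<in>I. orth_proj (W i)) \<and>
        loewner_le (\<Sum>i\<in>I. orth_proj (W i)) (B *\<^sub>R mat 1))"

definition tight_fusion_frame :: "'i set \<Rightarrow> ('i \<Rightarrow> (real^'n) set) \<Rightarrow> bool" where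
  "tight_fusion_frame I W \<longleftrightarrow> fusion_frame I W \<and>
     (\<exists>A>0. (\<Sum>i\<in>I. orth_proj (W i)) = A *\<^sub>R mat 1)"

text \<open>The norm of the type \<^typ>\<open>real^'n^'n\<close> is the Frobenius norm.\<close>

definition chordal_dist :: "(real^'n) set \<Rightarrow> (real^'n) set \<Rightarrow> real" where
  "chordal_dist V W = 1 / sqrt 2 * norm (orth_proj V - orth_proj W)"

end

theory Submission
  imports Defs
begin

text \<open>
  Let \<open>S\<close> be the sum of the \<open>N\<close> orthogonal projections \<open>P\<^sub>i\<close>, regarded as a point of the Euclidean
  space of matrices with the Frobenius inner product.  Since the trace is the inner product with
  the identity, \<open>S \<bullet> I = N m\<close>, so the multiple of the identity closest to \<open>S\<close> is
  \<open>(N m / M) I\<close>, and the frame is tight exactly when the squared distance from \<open>S\<close> to the line of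
  multiples of the identity vanishes, i.e. when Cauchy--Schwarz for \<open>S\<close> and \<open>I\<close> is an equality:
  \<open>M (S \<bullet> S) = (N m)\<^sup>2\<close>.

  On the other hand \<open>P\<^sub>i \<bullet> P\<^sub>i = m\<close>, and \<open>P\<^sub>i \<bullet> P\<^sub>j = m - d\<^sup>2\<close> for \<open>i \<noteq> j\<close> by the definition of the
  chordal distance, so that \<open>S \<bullet> S = N m + N (N - 1) (m - d\<^sup>2)\<close>.  Equating the two expressions
  and solving for \<open>d\<^sup>2\<close> gives the simplex bound.  The values of \<open>P \<bullet> I\<close> and \<open>P \<bullet> P\<close> both come from
  \<open>frobenius_inner_orth_proj\<close>, which evaluates the inner product with a projection in an
  orthonormal basis of its range.
\<close>

lemma orth_proj_eqI:
  fixes W :: "(real^'n) set"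
  assumes "subspace W" "is_orth_proj W P"
  shows "orth_proj W = P"
  using assms is_orth_proj_ex1 is_orth_proj_orth_proj by blast

lemma orth_proj_fixes:
  fixes W :: "(real^'n) set"
  assumes W: "subspace W" and w: "w \<in> W"
  shows "orth_proj W *v w = w"
proof -
  let ?r = "w - orth_proj W *v w"
  have P: "orth_proj W *v w \<in> W" "\<And>v. v \<in> W \<Longrightarrow> orthogonal ?r v"
    using is_orth_proj_orth_proj[OF W] by (auto simp: is_orth_proj_def)
  have "?r \<in> W"
    using W w P(1) by (simp add: subspace_diff)
  then have "orthogonal ?r ?r"
    by (rule P(2))
  then show ?thesis
    by (simp add: orthogonal_def)
qed

text \<open>The projection is the sum of the rank-one projections \<open>b b\<^sup>T\<close> over an orthonormal basis.\<close>

lemma orth_proj_orthonormal_basis: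
  fixes W B :: "(real^'n) set"
  assumes W: "subspace W" and B: "finite B" "pairwise orthogonal B"
    "\<And>b. b \<in> B \<Longrightarrow> norm b = 1" "span B = W"
  shows "orth_proj W = (\<chi> i j. \<Sum>b\<in>B. b $ i * b $ j)"
proof (rule orth_proj_eqI[OF W])
  let ?P = "(\<chi> i j. \<Sum>b\<in>B. b $ i * b $ j) :: real^'n^'n"
  have ap: "?P *v x = (\<Sum>b\<in>B. (b \<bullet> x) *\<^sub>R b)" for x
  proof (subst vec_eq_iff, intro allI)
    fix i
    have "(?P *v x) $ i = (\<Sum>j\<in>UNIV. \<Sum>b\<in>B. b $ i * b $ j * x $ j)"
      by (simp add: matrix_vector_mult_def sum_distrib_right)
    also have "\<dots> = (\<Sum>b\<in>B. \<Sum>j\<in>UNIV. b $ i * b $ j * x $ j)"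
      by (rule sum.swap)
    also have "\<dots> = (\<Sum>b\<in>B. (b \<bullet> x) *\<^sub>R b) $ i"
      by (simp add: inner_vec_def sum_distrib_left sum_distrib_right mult_ac)
    finally show "(?P *v x) $ i = (\<Sum>b\<in>B. (b \<bullet> x) *\<^sub>R b) $ i" .
  qed
  have "?P *v x \<in> W" for x
    unfolding ap B(4)[symmetric] by (intro span_sum span_scale span_base)
  moreover have "orthogonal (x - ?P *v x) w" if "w \<in> W" for x w
  proof -
    have "orthogonal (x - ?P *v x) c" if c: "c \<in> B" for c
    proof -
      have "(\<Sum>b\<in>B. (b \<bullet> x) * (b \<bullet> c)) = (\<Sum>b\<in>B. if b = c then c \<bullet> x else 0)"
      proof (rule sum.cong)
        fix b assume "b \<in> B"
        then show "(b \<bullet> x) * (b \<bullet> c) = (if b = c then c \<bullet> x else 0)"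
          using B(2,3) c by (auto simp: pairwise_def orthogonal_def norm_eq_1)
      qed simp
      then show ?thesis
        using B(1) c
        by (simp add: ap orthogonal_def inner_diff_left inner_sum_left inner_commute[of c x])
    qed
    then show ?thesis
      using that B(4) orthogonal_to_span[of w B "x - ?P *v x"] by blast
  qed
  ultimately show "is_orth_proj W ?P"
    by (simp add: is_orth_proj_def)
qed

text \<open>The Frobenius inner product with \<open>b b\<^sup>T\<close> is the value at \<open>b\<close> of the quadratic form.\<close>

lemma frobenius_inner_orth_proj:
  fixes W B :: "(real^'n) set" and A :: "real^'n^'n"
  assumes "subspace W" "finite B" "pairwise orthogonal B"
    "\<And>b. b \<in> B \<Longrightarrow> norm b = 1" "span B = W"
  shows "A \<bullet> orth_proj W = (\<Sum>b\<in>B. b \<bullet> (A *v b))"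
proof -
  have P: "orth_proj W = (\<chi> i j. \<Sum>b\<in>B. b $ i * b $ j)"
    by (rule orth_proj_orthonormal_basis) (use assms in auto)
  have "A \<bullet> orth_proj W = (\<Sum>i\<in>UNIV. \<Sum>j\<in>UNIV. \<Sum>b\<in>B. b $ i * (A $ i $ j * b $ j))"
    by (simp add: P inner_vec_def sum_distrib_left mult_ac)
  also have "\<dots> = (\<Sum>i\<in>UNIV. \<Sum>b\<in>B. \<Sum>j\<in>UNIV. b $ i * (A $ i $ j * b $ j))"
    by (intro sum.cong refl sum.swap)
  also have "\<dots> = (\<Sum>b\<in>B. \<Sum>i\<in>UNIV. \<Sum>j\<in>UNIV. b $ i * (A $ i $ j * b $ j))"
    by (rule sum.swap)
  also have "\<dots> = (\<Sum>b\<in>B. b \<bullet> (A *v b))"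
    by (simp add: inner_vec_def matrix_vector_mult_def sum_distrib_left)
  finally show ?thesis .
qed

text \<open>A matrix that fixes \<open>W\<close> pointwise has quadratic form 1 at each vector of an orthonormal basis
  of \<open>W\<close>.  The cases needed are the identity and the projection itself.\<close>

lemma frobenius_inner_orth_proj_eq_dim:
  fixes W :: "(real^'n) set" and A :: "real^'n^'n"
  assumes W: "subspace W" and A: "\<And>w. w \<in> W \<Longrightarrow> A *v w = w"
  shows "A \<bullet> orth_proj W = dim W"
proof -
  obtain B where B: "B \<subseteq> W" "pairwise orthogonal B" "\<And>b. b \<in> B \<Longrightarrow> norm b = 1"
    "independent B" "card B = dim W" "span B = W"
    using orthonormal_basis_subspace[OF W] by metis
  have "finite B"
    using B(4) independent_imp_finite by blast
  then have "A \<bullet> orth_proj W = (\<Sum>b\<in>B. b \<bullet> (A *v b))"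
    using W B by (intro frobenius_inner_orth_proj) auto
  also have "\<dots> = (\<Sum>b\<in>B. 1)"
    using A B(1,3) by (intro sum.cong) (auto simp: norm_eq_1)
  finally show ?thesis
    using B(5) by simp
qed

lemma chordal_dist_squared:
  fixes V W :: "(real^'n) set"
  assumes "subspace V" "subspace W"
  shows "(chordal_dist V W)\<^sup>2 = (real (dim V) + real (dim W)) / 2 - orth_proj V \<bullet> orth_proj W"
proof -
  have "(norm (orth_proj V - orth_proj W))\<^sup>2
      = real (dim V) + real (dim W) - 2 * (orth_proj V \<bullet> orth_proj W)"
    using assms
    by (simp add: power2_norm_eq_inner inner_diff_left inner_diff_right inner_commute
        frobenius_inner_orth_proj_eq_dim orth_proj_fixes)
  then show ?thesis
    by (simp add: chordal_dist_def power_divide field_simps)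
qed

text \<open>The equality case of Cauchy--Schwarz.  The coefficient is forced to be \<open>(x \<bullet> u) / (u \<bullet> u)\<close>
  by taking the inner product with \<open>u\<close>.\<close>

lemma scaleR_iff_inner_squared:
  fixes x u :: "'a::real_inner"
  assumes "u \<noteq> 0"
  shows "x = ((x \<bullet> u) / (u \<bullet> u)) *\<^sub>R u \<longleftrightarrow> (u \<bullet> u) * (x \<bullet> x) = (x \<bullet> u)\<^sup>2"
proof -
  let ?a = "(x \<bullet> u) / (u \<bullet> u)"
  have uu: "u \<bullet> u \<noteq> 0"
    using assms by simp
  have "(u \<bullet> u) * ((x - ?a *\<^sub>R u) \<bullet> (x - ?a *\<^sub>R u)) = (u \<bullet> u) * (x \<bullet> x) - (x \<bullet> u)\<^sup>2"
    using uu by (simp add: inner_diff_left inner_diff_right inner_commute power2_eq_square field_simps)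
  then show ?thesis
    using uu by (metis eq_iff_diff_eq_0 inner_eq_zero_iff mult_eq_0_iff)
qed

lemma frobenius_inner_mat_one: "(mat 1 :: real^'n^'n) \<bullet> mat 1 = real CARD('n)"
proof -
  have "(mat 1 :: real^'n^'n) \<bullet> mat 1
      = (\<Sum>i\<in>UNIV. \<Sum>j\<in>(UNIV :: 'n set). if i = j then 1 else 0)"
    unfolding inner_vec_def mat_def by (intro sum.cong) auto
  then show ?thesis
    by simp
qed

lemma inner_sum_sum_equiangular:
  fixes f :: "'i \<Rightarrow> 'a::real_inner"
  assumes "finite I" "\<And>i. i \<in> I \<Longrightarrow> f i \<bullet> f i = a"
    "\<And>i j. i \<in> I \<Longrightarrow> j \<in> I \<Longrightarrow> i \<noteq> j \<Longrightarrow> f i \<bullet> f j = c"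
  shows "(\<Sum>i\<in>I. f i) \<bullet> (\<Sum>i\<in>I. f i) = real (card I) * (a + (real (card I) - 1) * c)"
proof -
  have row: "(\<Sum>j\<in>I. f i \<bullet> f j) = a + (real (card I) - 1) * c" if i: "i \<in> I" for i
  proof -
    have "(\<Sum>j\<in>I. f i \<bullet> f j) = f i \<bullet> f i + (\<Sum>j\<in>I - {i}. f i \<bullet> f j)"
      using assms(1) i by (rule sum.remove)
    also have "(\<Sum>j\<in>I - {i}. f i \<bullet> f j) = (\<Sum>j\<in>I - {i}. c)"
      using assms(3) i by (intro sum.cong) auto
    moreover have "card I \<ge> 1"
      using assms(1) i by (metis One_nat_def Suc_leI card_gt_0_iff empty_iff)
    ultimately show ?thesis
      using assms(1,2) i by (simp add: of_nat_diff)
  qed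
  have "(\<Sum>i\<in>I. f i) \<bullet> (\<Sum>i\<in>I. f i) = (\<Sum>i\<in>I. \<Sum>j\<in>I. f i \<bullet> f j)"
    by (simp only: inner_sum_left, simp only: inner_sum_right)
  also have "\<dots> = (\<Sum>i\<in>I. a + (real (card I) - 1) * c)"
    by (intro sum.cong row refl)
  finally show ?thesis
    by simp
qed

theorem theorem4p3:
  fixes W :: "nat \<Rightarrow> (real^'M) set" and N m :: nat and d :: real
  assumes "N \<ge> 2" and "1 \<le> m" and "m \<le> CARD('M)"
    and "fusion_frame {1..N} W"
    and "\<And>i. i \<in> {1..N} \<Longrightarrow> dim (W i) = m"
    and "\<And>i j. i \<in> {1..N} \<Longrightarrow> j \<in> {1..N} \<Longrightarrow> i \<noteq> j \<Longrightarrow> chordal_dist (W i) (W j) = d"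
  shows "tight_fusion_frame {1..N} W \<longleftrightarrow>
    d\<^sup>2 = real m * (real CARD('M) - real m) / real CARD('M) * (real N / (real N - 1))"
proof -
  define P where "P i = orth_proj (W i)" for i
  define S where "S = (\<Sum>i\<in>{1..N}. P i)"
  let ?I = "mat 1 :: real^'M^'M"
  let ?M = "real CARD('M)"
  have sub: "subspace (W i)" if "i \<in> {1..N}" for i
    using assms(4) that by (auto simp: fusion_frame_def)
  have PP: "P i \<bullet> P i = m" if "i \<in> {1..N}" for i
    using frobenius_inner_orth_proj_eq_dim[OF sub orth_proj_fixes[OF sub]] assms(5) that
    by (simp add: P_def)
  have PQ: "P i \<bullet> P j = m - d\<^sup>2" if "i \<in> {1..N}" "j \<in> {1..N}" "i \<noteq> j" for i j
    using chordal_dist_squared[OF sub sub, of i j] assms(5,6) that by (simp add: P_def)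
  have "P i \<bullet> ?I = m" if "i \<in> {1..N}" for i
    using frobenius_inner_orth_proj_eq_dim[OF sub, of i ?I] assms(5) that
    by (simp add: P_def inner_commute)
  then have SI: "S \<bullet> ?I = real N * real m"
    by (simp add: S_def inner_sum_left)
  have SS: "S \<bullet> S = real N * (real m + (real N - 1) * (real m - d\<^sup>2))"
    using inner_sum_sum_equiangular[of "{1..N}" P "real m" "real m - d\<^sup>2"] PP PQ
    by (simp add: S_def)
  have II: "?I \<bullet> ?I = ?M"
    by (rule frobenius_inner_mat_one)
  have pos: "?M > 0" "real N > 1" "real m > 0"
    using assms(1,2) by auto
  have "?I \<noteq> 0"
    using II pos by force
  have "tight_fusion_frame {1..N} W \<longleftrightarrow> (\<exists>A>0. S = A *\<^sub>R ?I)"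
    using assms(4) by (simp add: tight_fusion_frame_def S_def P_def)
  also have "\<dots> \<longleftrightarrow> S = ((S \<bullet> ?I) / (?I \<bullet> ?I)) *\<^sub>R ?I"
  proof
    assume "\<exists>A>0. S = A *\<^sub>R ?I"
    then obtain A where A: "S = A *\<^sub>R ?I" by blast
    then have "(S \<bullet> ?I) / (?I \<bullet> ?I) = A"
      using II pos by simp
    with A show "S = ((S \<bullet> ?I) / (?I \<bullet> ?I)) *\<^sub>R ?I"
      by simp
  next
    assume "S = ((S \<bullet> ?I) / (?I \<bullet> ?I)) *\<^sub>R ?I"
    moreover have "(S \<bullet> ?I) / (?I \<bullet> ?I) > 0"
      using pos by (simp add: SI II)
    ultimately show "\<exists>A>0. S = A *\<^sub>R ?I"
      by blast
  qed
  also have "\<dots> \<longleftrightarrow> ?M * (S \<bullet> S) = (real N * real m)\<^sup>2"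
    using scaleR_iff_inner_squared[OF \<open>?I \<noteq> 0\<close>, of S] by (simp only: II SI)
  also have "\<dots> \<longleftrightarrow> ?M * (real m + (real N - 1) * (real m - d\<^sup>2)) = real N * (real m)\<^sup>2"
  proof -
    have "?M * (S \<bullet> S) = real N * (?M * (real m + (real N - 1) * (real m - d\<^sup>2)))"
      "(real N * real m)\<^sup>2 = real N * (real N * (real m)\<^sup>2)"
      by (simp_all only: SS power2_eq_square mult_ac)
    then show ?thesis
      using pos by simp
  qed
  also have "\<dots> \<longleftrightarrow> d\<^sup>2 * (?M * (real N - 1)) = real m * (?M - real m) * real N"
    by (auto simp: algebra_simps power2_eq_square)
  also have "\<dots> \<longleftrightarrow> d\<^sup>2 = real m * (?M - real m) / ?M * (real N / (real N - 1))"
    using pos by (simp add: eq_divide_eq)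
  finally show ?thesis .
qed

end
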